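(* Let $G$ be a connected efficient graph of order $n\geq 3$, and let $k$ be an integer with $m(G)\le k<\Delta(G)$. Then $\gamma_k^{\mathrm L}(G)=\gamma(G)$.
   Context: All graphs are finite, simple and undirected; $\Delta(G)$ is the maximum degree, $N(v)$ the open and $N[v]=N(v)\cup\{v\}$ the closed neighborhood of $v$. A dominating set of $G$ is a set $D\subseteq V(G)$ such that every vertex not in $D$ has a neighbor in $D$; $\gamma(G)$ is the minimum cardinality of a dominating set. For an integer $0\le k\le \Delta(G)$, a set $D\subseteq V(G)$ is a $k$-limited dominating set if $D$ is a dominating set and $|N(u)-D|\le k$ for every $u\in D$. $\gamma_k^{\mathrm L}(G)$ is the minimum cardinality of a $k$-limited dominating set of $G$. A set $S\subseteq V(G)$ is an efficient dominating set if $|N[v]\cap S|=1$ for every $v\in V(G)$; $G$ is an efficient graph if it admits at least one efficient dominating set. For an efficient dominating set $S$ put $M(S)=\max\{\deg(v): v\in S\}$, and for an efficient graph $G$ put $m(G)=\min\{M(S): S \text{ is an efficient dominating set of } G\}$. *)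

theory Defs
  imports "Graph_Theory.Digraph_Component"
begin

text \<open>
  A finite simple undirected graph is an instance of the locale \<open>graph\<close>: a finite symmetric
  digraph without loops and parallel arcs. An undirected edge is a pair of opposite arcs.
\<close>

definition open_nbhd :: "('a, 'b) pre_digraph \<Rightarrow> 'a \<Rightarrow> 'a set" where
  "open_nbhd G v = {u. v \<rightarrow>\<^bsub>G\<^esub> u}"

definition closed_nbhd :: "('a, 'b) pre_digraph \<Rightarrow> 'a \<Rightarrow> 'a set" where
  "closed_nbhd G v = insert v (open_nbhd G v)"

text \<open>
  Every undirected edge at a vertex contributes exactly one outgoing arc, so the library's
  \<^const>\<open>out_degree\<close> is the undirected degree.
\<close>

lemma (in graph) out_degree_eq_card_open_nbhd: "out_degree G v = card (open_nbhd G v)"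
proof -
  have "inj_on (head G) (out_arcs G v)"
    by (auto intro!: inj_onI no_multi_arcs simp: arc_to_ends_def)
  moreover have "head G ` out_arcs G v = open_nbhd G v"
    by (auto simp: open_nbhd_def arcs_ends_conv)
  ultimately show ?thesis
    unfolding out_degree_def by (metis card_image)
qed

definition max_degree :: "('a, 'b) pre_digraph \<Rightarrow> nat" where
  "max_degree G = Max (out_degree G ` verts G)"

definition dominating_set :: "('a, 'b) pre_digraph \<Rightarrow> 'a set \<Rightarrow> bool" where
  "dominating_set G D \<longleftrightarrow>
     D \<subseteq> verts G \<and> (\<forall>v \<in> verts G - D. \<exists>u \<in> D. u \<in> open_nbhd G v)"

definition domination_number :: "('a, 'b) pre_digraph \<Rightarrow> nat" where
  "domination_number G = Min (card ` {D. dominating_set G D})"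

text \<open>The intended range of \<open>k\<close> is \<open>0 \<le> k \<le> max_degree G\<close>.\<close>

definition limited_dominating_set :: "('a, 'b) pre_digraph \<Rightarrow> nat \<Rightarrow> 'a set \<Rightarrow> bool" where
  "limited_dominating_set G k D \<longleftrightarrow>
     dominating_set G D \<and> (\<forall>u \<in> D. card (open_nbhd G u - D) \<le> k)"

definition limited_domination_number :: "('a, 'b) pre_digraph \<Rightarrow> nat \<Rightarrow> nat" where
  "limited_domination_number G k = Min (card ` {D. limited_dominating_set G k D})"

text \<open>The minima above range over finite nonempty sets: the whole vertex set always qualifies.\<close>

lemma limited_dominating_set_verts: "limited_dominating_set G k (verts G)" if "wf_digraph G"
proof -
  interpret wf_digraph G by fact
  have "card (open_nbhd G u - verts G) = 0" for u
    by (auto simp: open_nbhd_def dest: adj_in_verts intro!: card_eq_0_iff[THEN iffD2])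
  then show ?thesis
    by (simp add: limited_dominating_set_def dominating_set_def)
qed

lemma (in fin_digraph) finite_dominating_sets:
  "finite {D. dominating_set G D}" "finite {D. limited_dominating_set G k D}"
  by (rule finite_subset[of _ "Pow (verts G)"];
      auto simp: dominating_set_def limited_dominating_set_def)+

definition efficient_dominating_set :: "('a, 'b) pre_digraph \<Rightarrow> 'a set \<Rightarrow> bool" where
  "efficient_dominating_set G S \<longleftrightarrow>
     S \<subseteq> verts G \<and> (\<forall>v \<in> verts G. card (closed_nbhd G v \<inter> S) = 1)"

definition efficient_graph :: "('a, 'b) pre_digraph \<Rightarrow> bool" where
  "efficient_graph G \<longleftrightarrow> (\<exists>S. efficient_dominating_set G S)"

definition max_degree_in :: "('a, 'b) pre_digraph \<Rightarrow> 'a set \<Rightarrow> nat" where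
  "max_degree_in G S = Max (out_degree G ` S)"

text \<open>Only meaningful for an efficient graph; otherwise the minimum is over the empty set.\<close>

definition min_max_degree :: "('a, 'b) pre_digraph \<Rightarrow> nat" where
  "min_max_degree G = Min (max_degree_in G ` {S. efficient_dominating_set G S})"

end

theory Submission
  imports Defs
begin

text \<open>
  The closed neighborhoods of the vertices of an efficient dominating set \<open>S\<close> partition the
  vertex set. A dominating set must meet every closed neighborhood, hence has at least as many
  vertices as there are blocks of this partition; since \<open>S\<close> itself is dominating, it is a minimum
  dominating set (\<open>card_efficient_dominating_set\<close>). A vertex of \<open>S\<close> has at most as many neighbors
  outside \<open>S\<close> as its degree, so an \<open>S\<close> whose largest degree is the minimum \<open>m(G) \<le> k\<close> is also
  \<open>k\<close>-limited. A minimum dominating set that is \<open>k\<close>-limited makes the two domination numbers equal.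
\<close>

lemma dominating_set_meets_closed_nbhd:
  assumes "dominating_set G D" and "v \<in> verts G"
  shows "closed_nbhd G v \<inter> D \<noteq> {}"
  using assms unfolding dominating_set_def closed_nbhd_def by blast

lemma efficient_dominating_set_unique:
  assumes "efficient_dominating_set G S" and "v \<in> verts G"
    and "s \<in> closed_nbhd G v \<inter> S" and "t \<in> closed_nbhd G v \<inter> S"
  shows "s = t"
proof -
  have "card (closed_nbhd G v \<inter> S) = 1"
    using assms by (simp add: efficient_dominating_set_def)
  then show ?thesis
    using assms(3,4) by (metis card_1_singletonE singletonD)
qed

lemma efficient_dominating_set_imp_dominating_set:
  assumes "efficient_dominating_set G S"
  shows "dominating_set G S"
proof -
  have "\<exists>u \<in> S. u \<in> open_nbhd G v" if "v \<in> verts G - S" for v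
  proof -
    have "card (closed_nbhd G v \<inter> S) = 1"
      using assms that by (simp add: efficient_dominating_set_def)
    then have "closed_nbhd G v \<inter> S \<noteq> {}"
      by auto
    then show ?thesis
      using that by (auto simp: closed_nbhd_def)
  qed
  then show ?thesis
    using assms by (simp add: dominating_set_def efficient_dominating_set_def)
qed

lemma (in sym_digraph) closed_nbhd_sym:
  assumes "u \<in> closed_nbhd G v"
  shows "v \<in> closed_nbhd G u"
  using assms arcs_ends_symmetric[OF sym_arcs] by (auto simp: closed_nbhd_def open_nbhd_def)

text \<open>
  Each vertex of \<open>S\<close> is dominated by some vertex of \<open>D\<close>. No vertex of \<open>D\<close> can serve two vertices
  of \<open>S\<close>, since its closed neighborhood contains only one vertex of \<open>S\<close>. So choosing dominators
  is an injection of \<open>S\<close> into \<open>D\<close>.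
\<close>

lemma (in pseudo_graph) card_efficient_dominating_set_le:
  assumes S: "efficient_dominating_set G S" and D: "dominating_set G D"
  shows "card S \<le> card D"
proof -
  have "\<forall>s \<in> S. \<exists>d. d \<in> closed_nbhd G s \<inter> D"
    using dominating_set_meets_closed_nbhd[OF D] S
    unfolding efficient_dominating_set_def by blast
  then obtain f where f: "\<And>s. s \<in> S \<Longrightarrow> f s \<in> closed_nbhd G s \<inter> D"
    by metis
  have D_verts: "D \<subseteq> verts G"
    using D by (simp add: dominating_set_def)
  have "inj_on f S"
  proof (rule inj_onI)
    fix s t assume st: "s \<in> S" "t \<in> S" "f s = f t"
    have "s \<in> closed_nbhd G (f s) \<inter> S" "t \<in> closed_nbhd G (f s) \<inter> S"
      using f[OF st(1)] f[OF st(2)] st by (auto intro: closed_nbhd_sym)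
    moreover have "f s \<in> verts G"
      using f[OF st(1)] D_verts by blast
    ultimately show "s = t"
      using efficient_dominating_set_unique[OF S] by blast
  qed
  moreover have "f ` S \<subseteq> D"
    using f by blast
  moreover have "finite D"
    using D_verts by (rule finite_subset) simp
  ultimately show ?thesis
    by (rule card_inj_on_le)
qed

lemma (in pseudo_graph) card_efficient_dominating_set:
  assumes "efficient_dominating_set G S"
  shows "card S = domination_number G"
  unfolding domination_number_def
  using assms efficient_dominating_set_imp_dominating_set[OF assms]
  by (intro Min_eqI[symmetric])
    (auto simp: finite_dominating_sets intro: card_efficient_dominating_set_le)

lemma (in graph) efficient_dominating_set_limited:
  assumes S: "efficient_dominating_set G S" and k: "max_degree_in G S \<le> k"
  shows "limited_dominating_set G k S"
proof -
  have fin: "finite S"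
    using S by (auto simp: efficient_dominating_set_def intro: finite_subset)
  have "card (open_nbhd G u - S) \<le> k" if "u \<in> S" for u
  proof -
    have "finite (open_nbhd G u)"
      by (rule finite_subset[of _ "verts G"]) (auto simp: open_nbhd_def dest: adj_in_verts)
    then have "card (open_nbhd G u - S) \<le> out_degree G u"
      by (auto simp: out_degree_eq_card_open_nbhd intro: card_mono)
    also have "\<dots> \<le> max_degree_in G S"
      unfolding max_degree_in_def using fin that by simp
    finally show ?thesis
      using k by simp
  qed
  then show ?thesis
    using efficient_dominating_set_imp_dominating_set[OF S]
    by (simp add: limited_dominating_set_def)
qed

lemma (in fin_digraph) min_max_degree_attained:
  assumes "efficient_graph G"
  obtains S where "efficient_dominating_set G S" and "max_degree_in G S = min_max_degree G"
proof -
  have "finite {S. efficient_dominating_set G S}"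
    by (rule finite_subset[of _ "Pow (verts G)"]) (auto simp: efficient_dominating_set_def)
  moreover have "{S. efficient_dominating_set G S} \<noteq> {}"
    using assms by (simp add: efficient_graph_def)
  ultimately have "min_max_degree G \<in> max_degree_in G ` {S. efficient_dominating_set G S}"
    unfolding min_max_degree_def by (intro Min_in) auto
  then show ?thesis
    using that by auto
qed

lemma (in fin_digraph) limited_domination_number_eqI:
  assumes "limited_dominating_set G k D" and "card D = domination_number G"
  shows "limited_domination_number G k = domination_number G"
  unfolding limited_domination_number_def
proof (rule Min_eqI)
  show "finite (card ` {D. limited_dominating_set G k D})"
    by (simp add: finite_dominating_sets)
  show "domination_number G \<in> card ` {D. limited_dominating_set G k D}"
    using assms by force
  show "domination_number G \<le> y" if "y \<in> card ` {D. limited_dominating_set G k D}" for y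
    using that unfolding domination_number_def
    by (auto simp: finite_dominating_sets limited_dominating_set_def)
qed

theorem proposition4:
  fixes G :: "('a, 'b) pre_digraph" and k :: nat
  assumes "graph G"
    and "connected G"
    and "efficient_graph G"
    and "card (verts G) \<ge> 3"
    and "min_max_degree G \<le> k"
    and "k < max_degree G"
  shows "limited_domination_number G k = domination_number G"
proof -
  interpret graph G by fact
  obtain S where S: "efficient_dominating_set G S" "max_degree_in G S = min_max_degree G"
    using min_max_degree_attained[OF \<open>efficient_graph G\<close>] .
  show ?thesis
  proof (rule limited_domination_number_eqI)
    show "limited_dominating_set G k S"
      using S \<open>min_max_degree G \<le> k\<close> by (simp add: efficient_dominating_set_limited)
    show "card S = domination_number G"
      using S(1) by (rule card_efficient_dominating_set)
  qed
qed

end
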